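(* Let $v\ge 2$ and let $M=M_2(v,3)$ be the $2$-inclusion matrix defined in the context, over the reals. There exists a basis of the null space $\{\mathbf T\in\mathbb R^{V^3}: M\mathbf T=\mathbf 0\}$ consisting only of (frequency vectors of) intercalates.
   Context: Let $V=\{0,1,\ldots,v-1\}$. For a $2$-subset $I=\{i_1<i_2\}$ of $\{1,2,3\}$ and $u_1,u_2\in V$, say $(u_1,u_2)_I\in(x_1,x_2,x_3)$ iff $u_1=x_{i_1}$ and $u_2=x_{i_2}$. The matrix $M_2(v,3)$ has columns indexed by $V^3$, rows indexed by all pairs $(u_1,u_2)_I$ with $I$ ranging over the $2$-subsets of $\{1,2,3\}$ and $u_1,u_2\in V$, and entry $1$ in row $(u_1,u_2)_I$, column $\mathbf x$ iff $(u_1,u_2)_I\in\mathbf x$, else $0$. A triple $(i,j,k)\in V^3$ is read as "symbol $k$ in cell $(i,j)$" of a $v\times v$ array. An intercalate is a Latin trade of volume $4$: given rows $r_1\neq r_2$, columns $c_1\ne c_2$ and symbols $a\neq b$ in $V$, its frequency vector $\mathbf T\in\mathbb R^{V^3}$ has $\mathbf T=+1$ at $(r_1,c_1,a),(r_2,c_2,a),(r_1,c_2,b),(r_2,c_1,b)$, $\mathbf T=-1$ at $(r_1,c_1,b),(r_2,c_2,b),(r_1,c_2,a),(r_2,c_1,a)$, and $0$ elsewhere (up to an overall sign, i.e., interchanging the two partial Latin squares). *)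

theory Defs
  imports "HOL-Analysis.Analysis"
begin

text \<open>
  The ground set \<open>V\<close> with \<open>v\<close> elements is the universe of a finite type \<open>'v\<close>, so
  \<open>v = CARD('v)\<close>; the names and the order of its elements play no role. The space of
  real vectors indexed by \<open>V\<^sup>3\<close> is then \<open>real ^ ('v \<times> 'v \<times> 'v)\<close>.
\<close>

typedef index_pair = "{I :: nat set. I \<subseteq> {1, 2, 3} \<and> card I = 2}"
  by (rule exI[of _ "{1, 2}"]) simp

instance index_pair :: finite
proof
  have "finite {I :: nat set. I \<subseteq> {1, 2, 3} \<and> card I = 2}"
    by (rule finite_subset[of _ "Pow {1, 2, 3}"]) auto
  then show "finite (UNIV :: index_pair set)"
    by (metis (no_types, lifting) finite_imageI type_definition.Abs_image
        type_definition_index_pair)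
qed

fun coord :: "'v \<times> 'v \<times> 'v \<Rightarrow> nat \<Rightarrow> 'v" where
  "coord (x1, x2, x3) i = (if i = 1 then x1 else if i = 2 then x2 else x3)"

text \<open>
  The triple \<open>(I, u1, u2)\<close> stands for the pair \<open>(u1, u2)\<^sub>I\<close>. For \<open>I = {i1 < i2}\<close> we have
  \<open>i1 = Min I\<close> and \<open>i2 = Max I\<close>.
\<close>

definition occurs_in :: "index_pair \<times> 'v \<times> 'v \<Rightarrow> 'v \<times> 'v \<times> 'v \<Rightarrow> bool" where
  "occurs_in = (\<lambda>(I, u1, u2) x.
     u1 = coord x (Min (Rep_index_pair I)) \<and> u2 = coord x (Max (Rep_index_pair I)))"

definition inclusion_matrix :: "real ^ ('v::finite \<times> 'v \<times> 'v) ^ (index_pair \<times> 'v \<times> 'v)" where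
  "inclusion_matrix = (\<chi> u x. if occurs_in u x then 1 else 0)"

definition intercalate ::
    "'v \<Rightarrow> 'v \<Rightarrow> 'v \<Rightarrow> 'v \<Rightarrow> 'v \<Rightarrow> 'v \<Rightarrow> real ^ ('v::finite \<times> 'v \<times> 'v)" where
  "intercalate r1 r2 c1 c2 a b = (\<chi> x.
     if x \<in> {(r1, c1, a), (r2, c2, a), (r1, c2, b), (r2, c1, b)} then 1
     else if x \<in> {(r1, c1, b), (r2, c2, b), (r1, c2, a), (r2, c1, a)} then - 1
     else 0)"

text \<open>
  Exchanging \<open>a\<close> and \<open>b\<close> negates the vector, so both signs are covered.
\<close>

definition is_intercalate :: "real ^ ('v::finite \<times> 'v \<times> 'v) \<Rightarrow> bool" where
  "is_intercalate T \<longleftrightarrow> (\<exists>r1 r2 c1 c2 a b. r1 \<noteq> r2 \<and> c1 \<noteq> c2 \<and> a \<noteq> b \<and>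
     T = intercalate r1 r2 c1 c2 a b)"

end

theory Submission
  imports Defs
begin

text \<open>
  An intercalate is a product \<open>(e r1 - e r2) \<otimes> (e c1 - e c2) \<otimes> (e a - e b)\<close> of differences of
  unit vectors, and \<open>M T = 0\<close> says that every line sum of \<open>T\<close> vanishes. Hence, for a fixed
  \<open>z\<close>, expanding \<open>T\<close> in the vectors \<open>(e i - e z) \<otimes> (e j - e z) \<otimes> (e k - e z)\<close> with
  coefficients \<open>T (i, j, k)\<close> gives \<open>T\<close> back: every term that contains an \<open>e z\<close> coming
  from a difference is multiplied by a line sum. So the intercalates span the null space, and
  some subset of them is a basis.
\<close>

lemma sum_UNIV_triple:
  fixes f :: "'a::finite \<times> 'b::finite \<times> 'c::finite \<Rightarrow> 'd::comm_monoid_add"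
  shows "sum f UNIV = (\<Sum>i\<in>UNIV. \<Sum>j\<in>UNIV. \<Sum>k\<in>UNIV. f (i, j, k))"
  by (simp add: sum.cartesian_product flip: UNIV_Times_UNIV)

text \<open>Moves a condition on an outer summation variable out of the inner sums, so that the
  outer sums collapse to a single term.\<close>

lemma sum_if_const:
  "(\<Sum>x\<in>A. if P then f x else 0) = (if P then sum f A else 0)"
  by simp

lemma Rep_index_pair_cases:
  "Rep_index_pair I = {1, 2} \<or> Rep_index_pair I = {1, 3} \<or> Rep_index_pair I = {2, 3}"
proof -
  have sub: "Rep_index_pair I \<subseteq> {1, 2, 3}" and card: "card (Rep_index_pair I) = 2"
    using Rep_index_pair[of I] by auto
  from card obtain p q where pq: "Rep_index_pair I = {p, q}" "p \<noteq> q"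
    unfolding card_2_iff by blast
  with sub have "p = 1 \<or> p = 2 \<or> p = 3" "q = 1 \<or> q = 2 \<or> q = 3" by blast+
  with pq show ?thesis by (elim disjE) (simp_all add: insert_commute)
qed

text \<open>Trades the abstract index type for three explicit sets, whose \<open>Min\<close> and
  \<open>Max\<close> simplification can evaluate.\<close>

lemma all_index_pair:
  "(\<forall>I. P (Rep_index_pair I)) \<longleftrightarrow> P {1, 2} \<and> P {1, 3} \<and> P {2, 3}"
proof
  assume all: "\<forall>I. P (Rep_index_pair I)"
  have "P A" if "A \<subseteq> {1, 2, 3}" "card A = 2" for A
    using all[rule_format, of "Abs_index_pair A"] that by (simp add: Abs_index_pair_inverse)
  then show "P {1, 2} \<and> P {1, 3} \<and> P {2, 3}" by simp
next
  assume P: "P {1, 2} \<and> P {1, 3} \<and> P {2, 3}"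
  show "\<forall>I. P (Rep_index_pair I)"
  proof
    fix I show "P (Rep_index_pair I)" using P Rep_index_pair_cases[of I] by auto
  qed
qed

text \<open>A row for \<open>I\<close> fixes the two coordinates in \<open>I\<close> and sums over
  the third, so the three choices of \<open>I\<close> give the three directions of lines.\<close>

lemma inclusion_matrix_null_iff:
  fixes T :: "real ^ ('v::finite \<times> 'v \<times> 'v)"
  shows "inclusion_matrix *v T = 0 \<longleftrightarrow>
    (\<forall>i j. (\<Sum>k\<in>UNIV. T $ (i, j, k)) = 0) \<and>
    (\<forall>i k. (\<Sum>j\<in>UNIV. T $ (i, j, k)) = 0) \<and>
    (\<forall>j k. (\<Sum>i\<in>UNIV. T $ (i, j, k)) = 0)"
proof -
  \<comment> \<open>The entry of the product in a row. The argument \<open>A\<close> is a bare set,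
    so that \<open>all_index_pair\<close> applies.\<close>
  define S where "S A p q = (\<Sum>x\<in>UNIV.
    if p = coord x (Min A) \<and> q = coord x (Max A) then T $ x else 0)" for A p q
  have "inclusion_matrix *v T = 0 \<longleftrightarrow> (\<forall>I. \<forall>p q. S (Rep_index_pair I) p q = 0)"
    by (simp add: vec_eq_iff matrix_vector_mult_def inclusion_matrix_def occurs_in_def S_def
        if_distrib[where f = "\<lambda>c. c * _"] cong: if_cong)
  also have "\<dots> \<longleftrightarrow> (\<forall>p q. S {1, 2} p q = 0) \<and> (\<forall>p q. S {1, 3} p q = 0) \<and>
      (\<forall>p q. S {2, 3} p q = 0)"
    by (rule all_index_pair)
  also have "S {1, 2} = (\<lambda>i j. \<Sum>k\<in>UNIV. T $ (i, j, k))"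
    by (intro ext) (simp add: S_def sum_UNIV_triple sum_if_const flip: if_if_eq_conj)
  also have "S {1, 3} = (\<lambda>i k. \<Sum>j\<in>UNIV. T $ (i, j, k))"
    by (intro ext) (simp add: S_def sum_UNIV_triple sum_if_const flip: if_if_eq_conj)
  also have "S {2, 3} = (\<lambda>j k. \<Sum>i\<in>UNIV. T $ (i, j, k))"
    by (intro ext) (simp add: S_def sum_UNIV_triple sum_if_const flip: if_if_eq_conj)
  finally show ?thesis .
qed

definition unit_diff :: "'v \<Rightarrow> 'v \<Rightarrow> 'v \<Rightarrow> real" where
  "unit_diff p q x = (if x = p then 1 else 0) - (if x = q then 1 else 0)"

lemma unit_diff_same [simp]: "unit_diff p p x = 0"
  by (simp add: unit_diff_def)

lemma sum_unit_diff [simp]: "(\<Sum>x\<in>UNIV. unit_diff p (q :: 'v::finite) x) = 0"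
  by (simp add: unit_diff_def sum_subtractf)

text \<open>The \<open>z\<close> parts of the differences add up to \<open>sum f UNIV\<close> times
  the unit vector at \<open>z\<close>, which vanishes.\<close>

lemma sum_mult_unit_diff:
  fixes f :: "'v::finite \<Rightarrow> real"
  assumes "sum f UNIV = 0"
  shows "(\<Sum>p\<in>UNIV. f p * unit_diff p z x) = f x"
proof -
  have "(\<Sum>p\<in>UNIV. f p * unit_diff p z x) =
      (\<Sum>p\<in>UNIV. if x = p then f p else 0) - (\<Sum>p\<in>UNIV. f p) * (if x = z then 1 else 0)"
    by (simp add: unit_diff_def sum_subtractf right_diff_distrib sum_distrib_right
        if_distrib[where f = "\<lambda>c. _ * c"] cong: if_cong)
  with assms show ?thesis by simp
qed

text \<open>Unlike \<open>intercalate\<close>, this is 0 when two paired arguments coincide, so the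
  expansion below may run over all indices.\<close>

definition diff_product ::
    "'v \<Rightarrow> 'v \<Rightarrow> 'v \<Rightarrow> 'v \<Rightarrow> 'v \<Rightarrow> 'v \<Rightarrow> real ^ ('v::finite \<times> 'v \<times> 'v)" where
  "diff_product r1 r2 c1 c2 a b =
    (\<chi> x. case x of (i, j, k) \<Rightarrow> unit_diff r1 r2 i * unit_diff c1 c2 j * unit_diff a b k)"

lemma diff_product_nth [simp]:
  "diff_product r1 r2 c1 c2 a b $ (i, j, k) =
    unit_diff r1 r2 i * unit_diff c1 c2 j * unit_diff a b k"
  by (simp add: diff_product_def)

text \<open>Both sides live on the same eight cells, with sign -1 where an odd number of coordinates
  come from \<open>r2\<close>, \<open>c2\<close>, \<open>b\<close>.\<close>

lemma intercalate_eq_diff_product: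
  assumes "r1 \<noteq> r2" "c1 \<noteq> c2" "a \<noteq> b"
  shows "intercalate r1 r2 c1 c2 a b = diff_product r1 r2 c1 c2 a b"
  using assms by (auto simp: vec_eq_iff intercalate_def unit_diff_def)

lemma diff_product_in_span_intercalates:
  "diff_product r1 r2 c1 c2 a b \<in> span {T. is_intercalate T}"
proof (cases "r1 \<noteq> r2 \<and> c1 \<noteq> c2 \<and> a \<noteq> b")
  case True
  then have "is_intercalate (diff_product r1 r2 c1 c2 a b)"
    unfolding is_intercalate_def using intercalate_eq_diff_product by metis
  then show ?thesis by (simp add: span_base)
next
  case False
  then have "diff_product r1 r2 c1 c2 a b = 0"
    by (auto simp: vec_eq_iff)
  then show ?thesis by (simp add: span_zero)
qed

lemma inclusion_matrix_mult_intercalate: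
  assumes "is_intercalate T"
  shows "inclusion_matrix *v T = 0"
proof -
  obtain r1 r2 c1 c2 a b where "T = diff_product r1 r2 c1 c2 a b"
    using assms intercalate_eq_diff_product unfolding is_intercalate_def by metis
  \<comment> \<open>Each line sum factors through the total of one \<open>unit_diff\<close>, which
    is 0.\<close>
  then show ?thesis
    by (simp add: inclusion_matrix_null_iff flip: sum_distrib_left sum_distrib_right)
qed

lemma null_space_expansion:
  fixes T :: "real ^ ('v::finite \<times> 'v \<times> 'v)"
  assumes "inclusion_matrix *v T = 0"
  shows "T = (\<Sum>i\<in>UNIV. \<Sum>j\<in>UNIV. \<Sum>k\<in>UNIV. T $ (i, j, k) *\<^sub>R diff_product i z j z k z)"
proof -
  note null = assms[unfolded inclusion_matrix_null_iff]
  have "(\<Sum>i\<in>UNIV. \<Sum>j\<in>UNIV. \<Sum>k\<in>UNIV.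
      T $ (i, j, k) * (unit_diff i z x * unit_diff j z y * unit_diff k z w)) = T $ (x, y, w)"
    for x y w
  proof -
    \<comment> \<open>In nested form the sums over \<open>k\<close>, \<open>j\<close> and
      \<open>i\<close> are evaluated in turn by \<open>sum_mult_unit_diff\<close>, each using the
      line sums in its own direction.\<close>
    have "(\<Sum>i\<in>UNIV. \<Sum>j\<in>UNIV. \<Sum>k\<in>UNIV.
        T $ (i, j, k) * (unit_diff i z x * unit_diff j z y * unit_diff k z w)) =
      (\<Sum>i\<in>UNIV. (\<Sum>j\<in>UNIV. (\<Sum>k\<in>UNIV. T $ (i, j, k) * unit_diff k z w)
        * unit_diff j z y) * unit_diff i z x)"
      by (simp add: sum_distrib_left sum_distrib_right mult_ac)
    then show ?thesis using null by (simp add: sum_mult_unit_diff)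
  qed
  then show ?thesis by (simp add: vec_eq_iff)
qed

lemma span_intercalates:
  "span {T :: real ^ ('v::finite \<times> 'v \<times> 'v). is_intercalate T} = {T. inclusion_matrix *v T = 0}"
proof (rule antisym)
  have "subspace {T :: real ^ ('v \<times> 'v \<times> 'v). inclusion_matrix *v T = 0}"
    by (simp add: subspace_def matrix_vector_right_distrib matrix_vector_mult_scaleR)
  then show "span {T. is_intercalate T} \<subseteq> {T :: real ^ ('v \<times> 'v \<times> 'v). inclusion_matrix *v T = 0}"
    by (intro span_minimal) (auto simp: inclusion_matrix_mult_intercalate)
  show "{T :: real ^ ('v \<times> 'v \<times> 'v). inclusion_matrix *v T = 0} \<subseteq> span {T. is_intercalate T}"
  proof
    fix T :: "real ^ ('v \<times> 'v \<times> 'v)"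
    assume "T \<in> {T. inclusion_matrix *v T = 0}"
    \<comment> \<open>Here \<open>undefined\<close> merely serves as some fixed element
      \<open>z\<close>.\<close>
    then have "T = (\<Sum>i\<in>UNIV. \<Sum>j\<in>UNIV. \<Sum>k\<in>UNIV.
        T $ (i, j, k) *\<^sub>R diff_product i undefined j undefined k undefined)"
      by (intro null_space_expansion) simp
    also have "\<dots> \<in> span {T. is_intercalate T}"
      by (intro span_sum span_scale diff_product_in_span_intercalates)
    finally show "T \<in> span {T. is_intercalate T}" .
  qed
qed

theorem theorem2:
  assumes "CARD('v::finite) \<ge> 2"
  shows "\<exists>B :: (real ^ ('v \<times> 'v \<times> 'v)) set.
           (\<forall>T \<in> B. is_intercalate T) \<and>
           independent B \<and>
           span B = {T. inclusion_matrix *v T = 0}"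
proof -
  obtain B :: "(real ^ ('v \<times> 'v \<times> 'v)) set"
    where B: "B \<subseteq> {T. is_intercalate T}" "independent B" "{T. is_intercalate T} \<subseteq> span B"
    using maximal_independent_subset by blast
  then have "span B = span {T. is_intercalate T}"
    by (simp add: span_eq span_mono subset_trans[OF _ span_superset])
  with B span_intercalates show ?thesis by blast
qed

end
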